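(* Let $E$ and $F$ be real $F^*$-spaces, and suppose there exists a real number $r>0$ such that $$\alpha_F(r)=\inf\left\{\frac{\|2x\|}{\|x\|} : x\in F,\ 0<\|2x\|\leq r\right\}>1.$$ Let $V:E\to F$ be an isometry with $V(0)=0$, i.e. $$\|Vx-Vy\|=\|x-y\|\quad\text{for all } x,y\in E,$$ and suppose that $$2V(x)-V(y)\in V(E)\quad\text{for all } x,y\in E.$$ Then $V$ is linear.
   Context: All linear spaces are over $\mathbb{R}$. An $F$-norm on a linear space $E$ is a non-negative function $\|\cdot\|$ on $E$ such that: (i) $\|x\|=0$ iff $x=0$; (ii) $\|ax\|=\|x\|$ for all $x\in E$ and all scalars $a$ with $|a|=1$; (iii) $\|x+y\|\le\|x\|+\|y\|$ for all $x,y\in E$; (iv) for each $x\in E$, $\|a_nx\|\to 0$ whenever the scalars $a_n\to 0$; (v) for each scalar $a$, $\|ax_n\|\to 0$ whenever $\|x_n\|\to 0$. An $F^*$-space is a linear space equipped with an $F$-norm (completeness is not required); it carries the translation-invariant metric $d(x,y)=\|x-y\|$. The infimum of the empty set is $+\infty$ (this is relevant only if $F=\{0\}$). The isometry $V$ is not assumed surjective. *)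

theory Defs
  imports Complex_Main "HOL-Library.Extended_Real"
begin

text \<open>
  An \<open>F\<^sup>*\<close>-space is a type of class \<^class>\<open>real_vector\<close> together with an \<open>F\<close>-norm. The \<open>F\<close>-norm is an
  explicit function, since the library class \<^class>\<open>real_normed_vector\<close> would impose homogeneity.
\<close>

locale F_norm =
  fixes N :: "'a::real_vector \<Rightarrow> real"
  assumes nonneg: "0 \<le> N x"
    and eq_0_iff: "N x = 0 \<longleftrightarrow> x = 0"
    and scale_unit: "\<bar>a\<bar> = 1 \<Longrightarrow> N (a *\<^sub>R x) = N x"
    and triangle: "N (x + y) \<le> N x + N y"
    and scale_null_seq: "s \<longlonglongrightarrow> 0 \<Longrightarrow> (\<lambda>n. N (s n *\<^sub>R x)) \<longlonglongrightarrow> 0"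
    and null_seq_scale: "(\<lambda>n. N (X n)) \<longlonglongrightarrow> 0 \<Longrightarrow> (\<lambda>n. N (a *\<^sub>R X n)) \<longlonglongrightarrow> 0"

text \<open>
  The infimum is taken in \<^typ>\<open>ereal\<close>, so that it is \<open>\<infinity>\<close> for an empty index set. The quotient is
  taken in \<^typ>\<open>real\<close>; its denominator is nonzero, as \<open>N (2 *\<^sub>R x) > 0\<close> forces \<open>x \<noteq> 0\<close>.
\<close>

definition doubling_inf :: "('a::real_vector \<Rightarrow> real) \<Rightarrow> real \<Rightarrow> ereal" where
  "doubling_inf N r = (INF x \<in> {x. 0 < N (2 *\<^sub>R x) \<and> N (2 *\<^sub>R x) \<le> r}. ereal (N (2 *\<^sub>R x) / N x))"

end

theory Submission
  imports Defs
begin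

text \<open>
  The argument is Vaisala's proof of the Mazur--Ulam theorem, localised. Let \<open>2V(m) - V(x) = V(x')\<close>
  with \<open>x\<close> close to \<open>m\<close>, and let \<open>\<sigma>\<close> be the isometry of \<open>E\<close> obtained by pulling back the reflection of
  \<open>V(E)\<close> in \<open>V(m)\<close>. If a surjective isometry \<open>g\<close> of \<open>E\<close> fixes \<open>x\<close> and \<open>x'\<close>, then so does
  \<open>\<sigma> g\<^sup>-\<^sup>1 \<sigma> g\<close>, which moves \<open>m\<close> further than \<open>g\<close> does by a factor greater than \<open>1\<close>. The displacements
  being bounded, \<open>g\<close> fixes \<open>m\<close>. Composing \<open>\<sigma>\<close> with the reflection of \<open>E\<close> in \<open>(x + x') / 2\<close> yields
  \<open>m = (x + x') / 2\<close>. So \<open>V\<close> preserves midpoints of short segments; subdividing, of all segments.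
\<close>

text \<open>Replacing \<open>h\<close> by
  \<open>\<sigma> \<circ> inv h \<circ> \<sigma> \<circ> h\<close> multiplies the displacement of
  \<open>c\<close> by at least \<open>\<alpha>\<close>. The local assumption \<open>expand\<close>
  suffices, because an isometry fixing \<open>a\<close> moves \<open>c\<close> by at most
  \<open>2 * d a c\<close>.\<close>

lemma isometry_fixes_centre:
  fixes d :: "'a \<Rightarrow> 'a \<Rightarrow> real" and \<alpha> :: real
  assumes "1 < \<alpha>"
    and d_nonneg: "\<And>u v. 0 \<le> d u v"
    and d_eq_0: "\<And>u v. d u v = 0 \<Longrightarrow> u = v"
    and d_sym: "\<And>u v. d u v = d v u"
    and d_triangle: "\<And>u v w. d u w \<le> d u v + d v w"
    and \<sigma>_invol: "\<And>u. \<sigma> (\<sigma> u) = u"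
    and \<sigma>_iso: "\<And>u v. d (\<sigma> u) (\<sigma> v) = d u v"
    and "\<sigma> a = b" and "\<sigma> c = c"
    and expand: "\<And>u. d u c \<le> 2 * d a c \<Longrightarrow> \<alpha> * d u c \<le> d (\<sigma> u) u"
    and "bij g" and "\<And>u v. d (g u) (g v) = d u v" and "g a = a" and "g b = b"
  shows "g c = c"
proof -
  have displ: "d (h c) c \<le> 2 * d a c"
    if "\<And>u v. d (h u) (h v) = d u v" "h a = a" for h
    using d_triangle[of "h c" c a] that(1)[of c a] that(2) d_sym[of c a] by simp
  have pow: "\<alpha> ^ n * d (h c) c \<le> 2 * d a c"
    if "bij h" "\<And>u v. d (h u) (h v) = d u v" "h a = a" "h b = b" for n h
    using that
  proof (induction n arbitrary: h)
    case 0
    then show ?case using displ by simp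
  next
    case (Suc n)
    \<comment> \<open>As \<open>\<sigma>\<close> swaps \<open>a\<close> and \<open>b\<close> and
      \<open>h\<close> fixes both, \<open>k\<close> fixes both again; the induction hypothesis,
      being for arbitrary isometries, applies to it.\<close>
    define k where "k = \<sigma> \<circ> inv h \<circ> \<sigma> \<circ> h"
    have hinv: "h (inv h u) = u" "inv h (h u) = u" for u
      using Suc.prems(1) by (simp_all add: bij_is_surj surj_f_inv_f bij_is_inj)
    have inv_iso: "d (inv h u) (inv h v) = d u v" for u v
      using Suc.prems(2)[of "inv h u" "inv h v"] hinv by simp
    have "bij \<sigma>"
      using \<sigma>_invol by (rule involuntory_imp_bij)
    then have "bij k"
      unfolding k_def using Suc.prems(1) by (intro bij_comp bij_imp_bij_inv)
    moreover have "d (k u) (k v) = d u v" for u v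
      unfolding k_def by (simp add: \<sigma>_iso inv_iso Suc.prems(2))
    moreover have "k a = a" "k b = b"
      unfolding k_def using \<open>\<sigma> a = b\<close> \<sigma>_invol[of a] Suc.prems(3,4) hinv(2)[of a] hinv(2)[of b]
      by simp_all
    ultimately have "\<alpha> ^ n * d (k c) c \<le> 2 * d a c"
      by (rule Suc.IH)
    \<comment> \<open>Apply \<open>\<sigma>\<close>, which fixes \<open>c\<close>, and then
      \<open>h\<close> to both arguments.\<close>
    moreover have "d (k c) c = d (\<sigma> (h c)) (h c)"
    proof -
      have "d (k c) c = d (inv h (\<sigma> (h c))) c"
        using \<sigma>_iso[of "inv h (\<sigma> (h c))" c] \<open>\<sigma> c = c\<close> by (simp add: k_def)
      also have "\<dots> = d (\<sigma> (h c)) (h c)"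
        using Suc.prems(2)[of "inv h (\<sigma> (h c))" c] hinv by simp
      finally show ?thesis .
    qed
    moreover have "\<alpha> * d (h c) c \<le> d (\<sigma> (h c)) (h c)"
      using expand displ Suc.prems(2,3) by blast
    then have "\<alpha> ^ n * (\<alpha> * d (h c) c) \<le> \<alpha> ^ n * d (\<sigma> (h c)) (h c)"
      using \<open>1 < \<alpha>\<close> by (intro mult_left_mono) auto
    ultimately show ?case
      by (simp add: mult_ac)
  qed
  have "d (g c) c = 0"
  proof (rule ccontr)
    assume "d (g c) c \<noteq> 0"
    then have "0 < d (g c) c"
      using d_nonneg[of "g c" c] by simp
    moreover obtain n where "2 * d a c / d (g c) c < \<alpha> ^ n"
      using real_arch_pow[OF \<open>1 < \<alpha>\<close>] by blast
    ultimately show False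
      using pow[of g n] assms(11-14) by (simp add: divide_less_eq)
  qed
  then show ?thesis
    by (rule d_eq_0)
qed

context F_norm
begin

lemma minus [simp]: "N (- x) = N x"
  using scale_unit[of "-1" x] by simp

lemma diff_commute: "N (x - y) = N (y - x)"
  using minus[of "x - y"] by simp

lemma triangle_diff: "N (x - z) \<le> N (x - y) + N (y - z)"
  using triangle[of "x - y" "y - z"] by simp

lemma double_le: "N (2 *\<^sub>R x) \<le> 2 * N x"
  using triangle[of x x] by (simp add: scaleR_2)

text \<open>A real factor strictly between 1 and the infimum also covers an infinite infimum. The
  vector 0, excluded from the index set, satisfies the inequality trivially.\<close>

lemma doubling_inf_gt_1D:
  assumes "1 < doubling_inf N r"
  obtains \<alpha> where "1 < \<alpha>" "\<And>x. N (2 *\<^sub>R x) \<le> r \<Longrightarrow> \<alpha> * N x \<le> N (2 *\<^sub>R x)"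
proof -
  obtain \<alpha> where \<alpha>: "1 < ereal \<alpha>" "ereal \<alpha> < doubling_inf N r"
    using ereal_dense2[OF assms] by blast
  have "\<alpha> * N x \<le> N (2 *\<^sub>R x)" if "N (2 *\<^sub>R x) \<le> r" for x
  proof (cases "x = 0")
    case True
    then show ?thesis using eq_0_iff[of 0] by simp
  next
    case False
    then have pos: "0 < N x" "0 < N (2 *\<^sub>R x)"
      using nonneg[of x] nonneg[of "2 *\<^sub>R x"] eq_0_iff[of x] eq_0_iff[of "2 *\<^sub>R x"] by auto
    then have "doubling_inf N r \<le> ereal (N (2 *\<^sub>R x) / N x)"
      unfolding doubling_inf_def using that by (intro INF_lower) simp
    then have "ereal \<alpha> < ereal (N (2 *\<^sub>R x) / N x)"
      using \<alpha>(2) by (rule less_le_trans[rotated])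
    then show ?thesis
      using pos by (simp add: less_divide_eq)
  qed
  with \<alpha>(1) show thesis
    by (intro that) (simp_all add: one_ereal_def)
qed

end

text \<open>By \<open>refl\<close> the reflection in \<open>V m\<close> maps \<open>range V\<close>
  into itself, so it pulls back along the injective \<open>V\<close> to an isometric involution
  \<open>\<sigma>\<close> fixing \<open>m\<close>.\<close>

lemma isometry_preserves_short_midpoint:
  fixes V :: "'e::real_vector \<Rightarrow> 'f::real_vector"
  assumes "F_norm N" and "F_norm M"
    and "1 < \<alpha>" and expand: "\<And>y. M (2 *\<^sub>R y) \<le> r \<Longrightarrow> \<alpha> * M y \<le> M (2 *\<^sub>R y)"
    and iso: "\<And>x y. M (V x - V y) = N (x - y)"
    and refl: "\<And>x y. 2 *\<^sub>R V x - V y \<in> range V"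
    and short: "4 * N h \<le> r"
  shows "V (m + h) + V (m - h) = 2 *\<^sub>R V m"
proof -
  interpret E: F_norm N by fact
  interpret F: F_norm M by fact
  have "inj V"
  proof (rule injI)
    fix x y assume "V x = V y"
    then show "x = y"
      using iso[of x y] E.eq_0_iff[of "x - y"] F.eq_0_iff[of 0] by simp
  qed
  define x where "x = m + h"
  define \<sigma> where "\<sigma> u = inv V (2 *\<^sub>R V m - V u)" for u
  have V\<sigma>: "V (\<sigma> u) = 2 *\<^sub>R V m - V u" for u
    unfolding \<sigma>_def using refl by (rule f_inv_into_f)
  have \<sigma>_invol: "\<sigma> (\<sigma> u) = u" for u
    by (intro injD[OF \<open>inj V\<close>]) (simp add: V\<sigma>)
  have \<sigma>_iso: "N (\<sigma> u - \<sigma> v) = N (u - v)" for u v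
    using iso[of "\<sigma> u" "\<sigma> v"] iso[of v u] E.diff_commute[of u v] by (simp add: V\<sigma>)
  have \<sigma>_m: "\<sigma> m = m"
    by (intro injD[OF \<open>inj V\<close>]) (simp add: V\<sigma> scaleR_2)
  define s where "s = x + \<sigma> x"
  \<comment> \<open>\<open>g\<close> is \<open>\<sigma>\<close> followed by the reflection in the
    midpoint of \<open>x\<close> and \<open>\<sigma> x\<close>. Each of the two swaps these points,
    so \<open>g\<close> fixes both; \<open>g m = m\<close> then says
    \<open>s = 2 *\<^sub>R m\<close>.\<close>
  define g where "g u = s - \<sigma> u" for u
  have "g m = m"
  proof (rule isometry_fixes_centre[where d = "\<lambda>u v. N (u - v)" and a = x and \<sigma> = \<sigma> and \<alpha> = \<alpha>])
    fix u assume u: "N (u - m) \<le> 2 * N (x - m)"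
    \<comment> \<open>Under \<open>V\<close>, the displacement by \<open>\<sigma>\<close> becomes a
      doubled vector, to which the doubling bound applies.\<close>
    have eq: "N (\<sigma> u - u) = M (2 *\<^sub>R (V m - V u))"
      using iso[of "\<sigma> u" u] by (simp add: V\<sigma> scaleR_2 algebra_simps)
    have Mum: "M (V m - V u) = N (u - m)"
      by (simp add: iso E.diff_commute)
    \<comment> \<open>The 4 in \<open>short\<close>: one factor 2 from the radius
      \<open>2 * N (x - m)\<close>, another from doubling.\<close>
    have "M (2 *\<^sub>R (V m - V u)) \<le> r"
      using F.double_le[of "V m - V u"] u short by (simp add: Mum x_def)
    from expand[OF this] show "\<alpha> * N (u - m) \<le> N (\<sigma> u - u)"
      by (simp add: eq Mum)
  next
    show "bij g"
      \<comment> \<open>The inverse of \<open>g\<close> undoes the reflection first and then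
        \<open>\<sigma>\<close>.\<close>
      by (rule bijI[OF injI surjI[where f = "\<lambda>u. \<sigma> (s - u)"]])
        (auto simp: g_def \<sigma>_invol dest: arg_cong[where f = \<sigma>])
    show "N (g u - g v) = N (u - v)" for u v
      using \<sigma>_iso[of v u] E.diff_commute[of u v] by (simp add: g_def)
  qed (use \<open>1 < \<alpha>\<close> in \<open>auto simp: g_def s_def \<sigma>_invol \<sigma>_iso \<sigma>_m E.nonneg E.eq_0_iff
        intro: E.diff_commute E.triangle_diff\<close>)
  then have "\<sigma> x = m - h"
    by (simp add: g_def s_def \<sigma>_m x_def algebra_simps)
  then show ?thesis
    using V\<sigma>[of x] by (simp add: x_def)
qed

text \<open>Cut \<open>h\<close> into equal short steps. For these the midpoint identity is a
  second-order recurrence, so \<open>V\<close> runs through an arithmetic progression along the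
  ray.\<close>

lemma short_midpoints_imp_midpoints:
  fixes V :: "'e::real_vector \<Rightarrow> 'f::real_vector"
  assumes "F_norm N" and "0 < \<delta>"
    and mid: "\<And>m h. N h \<le> \<delta> \<Longrightarrow> V (m + h) + V (m - h) = 2 *\<^sub>R V m"
  shows "V (m + h) + V (m - h) = 2 *\<^sub>R V m"
proof -
  interpret F_norm N by fact
  have "(\<lambda>n. N (inverse (real (Suc n)) *\<^sub>R h)) \<longlonglongrightarrow> 0"
    by (intro scale_null_seq LIMSEQ_inverse_real_of_nat)
  then have "\<forall>\<^sub>F n in sequentially. N (inverse (real (Suc n)) *\<^sub>R h) < \<delta>"
    using \<open>0 < \<delta>\<close> by (rule order_tendstoD)
  then obtain n where n: "N (inverse (real (Suc n)) *\<^sub>R h) < \<delta>"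
    by (auto simp: eventually_sequentially)
  define k where "k = inverse (real (Suc n)) *\<^sub>R h"
  have arith: "V (m + real j *\<^sub>R t) = V m + real j *\<^sub>R (V (m + t) - V m)"
    if "N t \<le> \<delta>" for t j
  proof (induction j rule: induct_nat_012)
    case (ge2 j)
    have "V (m + real (Suc (Suc j)) *\<^sub>R t) + V (m + real j *\<^sub>R t) = 2 *\<^sub>R V (m + real (Suc j) *\<^sub>R t)"
      using mid[OF that, of "m + real (Suc j) *\<^sub>R t"] by (simp add: algebra_simps scaleR_2)
    then have "V (m + real (Suc (Suc j)) *\<^sub>R t)
        = 2 *\<^sub>R V (m + real (Suc j) *\<^sub>R t) - V (m + real j *\<^sub>R t)"
      by (simp only: eq_diff_eq)
    also have "\<dots> = 2 *\<^sub>R (V m + real (Suc j) *\<^sub>R (V (m + t) - V m)) - (V m + real j *\<^sub>R (V (m + t) - V m))"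
      by (simp only: ge2)
    also have "\<dots> = V m + real (Suc (Suc j)) *\<^sub>R (V (m + t) - V m)"
      by (simp add: algebra_simps scaleR_2 del: scaleR_scaleR)
    finally show ?case .
  qed simp_all
  have k: "N k \<le> \<delta>" "real (Suc n) *\<^sub>R k = h"
    using n by (simp_all add: k_def del: of_nat_Suc)
  \<comment> \<open>Add the progressions from \<open>m\<close> with steps \<open>k\<close> and
    \<open>- k\<close>; their increments cancel by \<open>mid\<close> at \<open>m\<close>.\<close>
  have "V (m + h) + V (m - h)
      = 2 *\<^sub>R V m + real (Suc n) *\<^sub>R (V (m + k) + V (m - k) - 2 *\<^sub>R V m)"
    using arith[of k "Suc n"] arith[of "- k" "Suc n"] k
    by (simp add: algebra_simps scaleR_2 del: of_nat_Suc)
  then show ?thesis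
    using mid[OF k(1), of m] by simp
qed

text \<open>Additivity gives rational scalars; real ones follow by approximation, using axiom
  \<open>scale_null_seq\<close> in both spaces.\<close>

lemma additive_isometry_scaleR:
  fixes V :: "'e::real_vector \<Rightarrow> 'f::real_vector"
  assumes "F_norm N" and "F_norm M" and iso: "\<And>x y. M (V x - V y) = N (x - y)"
    and add: "\<And>x y. V (x + y) = V x + V y"
  shows "V (a *\<^sub>R x) = a *\<^sub>R V x"
proof -
  interpret E: F_norm N by fact
  interpret F: F_norm M by fact
  interpret additive V by (unfold_locales) (rule add)
  have nat: "V (real n *\<^sub>R y) = real n *\<^sub>R V y" for n y
    by (induction n) (simp_all add: zero add algebra_simps)
  have int: "V (of_int i *\<^sub>R y) = of_int i *\<^sub>R V y" for i y
    by (cases i rule: int_cases2) (simp_all add: nat minus)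
  \<comment> \<open>Rational approximations of \<open>a\<close> from below, with error at most
    \<open>inverse (real (Suc n))\<close>.\<close>
  define q where "q n = of_int \<lfloor>real (Suc n) * a\<rfloor> / real (Suc n)" for n
  have rat: "V (q n *\<^sub>R x) = q n *\<^sub>R V x" for n
  proof -
    have "real (Suc n) *\<^sub>R V (q n *\<^sub>R x) = V (of_int \<lfloor>real (Suc n) * a\<rfloor> *\<^sub>R x)"
      by (simp add: q_def flip: nat del: of_nat_Suc)
    also have "\<dots> = real (Suc n) *\<^sub>R (q n *\<^sub>R V x)"
      by (simp add: q_def int del: of_nat_Suc)
    finally show ?thesis
      by (simp del: of_nat_Suc scaleR_scaleR)
  qed
  have lim: "(\<lambda>n. a - q n) \<longlonglongrightarrow> 0"
  proof (rule tendsto_sandwich[OF _ _ tendsto_const LIMSEQ_inverse_real_of_nat])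
    have "q n \<le> a" "a - q n \<le> inverse (real (Suc n))" for n
    proof -
      show "q n \<le> a"
        unfolding q_def by (subst divide_le_eq) (simp add: mult.commute del: of_nat_Suc)
      have "real (Suc n) * a \<le> of_int \<lfloor>real (Suc n) * a\<rfloor> + 1"
        by linarith
      then have "a \<le> (of_int \<lfloor>real (Suc n) * a\<rfloor> + 1) / real (Suc n)"
        by (subst le_divide_eq) (simp add: mult.commute del: of_nat_Suc)
      then show "a - q n \<le> inverse (real (Suc n))"
        by (simp add: q_def add_divide_distrib inverse_eq_divide del: of_nat_Suc)
    qed
    then show "\<forall>\<^sub>F n in sequentially. 0 \<le> a - q n"
      "\<forall>\<^sub>F n in sequentially. a - q n \<le> inverse (real (Suc n))"
      by simp_all
  qed
  \<comment> \<open>Triangle inequality through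
    \<open>V (q n *\<^sub>R x) = q n *\<^sub>R V x\<close>; the isometry turns the first distance
    into one in the domain.\<close>
  have "M (V (a *\<^sub>R x) - a *\<^sub>R V x) \<le> N ((a - q n) *\<^sub>R x) + M ((a - q n) *\<^sub>R V x)" for n
    using F.triangle_diff[of "V (a *\<^sub>R x)" "a *\<^sub>R V x" "V (q n *\<^sub>R x)"]
      F.diff_commute[of "q n *\<^sub>R V x" "a *\<^sub>R V x"]
    by (simp add: iso rat flip: scaleR_diff_left)
      (simp add: rat iso[symmetric] scaleR_diff_left)
  moreover have "(\<lambda>n. N ((a - q n) *\<^sub>R x) + M ((a - q n) *\<^sub>R V x)) \<longlonglongrightarrow> 0 + 0"
    by (intro tendsto_add E.scale_null_seq F.scale_null_seq lim)
  ultimately have "M (V (a *\<^sub>R x) - a *\<^sub>R V x) \<le> 0"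
    using LIMSEQ_le_const by fastforce
  then show ?thesis
    using F.nonneg[of "V (a *\<^sub>R x) - a *\<^sub>R V x"] F.eq_0_iff[of "V (a *\<^sub>R x) - a *\<^sub>R V x"] by simp
qed

theorem corollary2p4:
  fixes normE :: "'e::real_vector \<Rightarrow> real"
    and normF :: "'f::real_vector \<Rightarrow> real"
    and V :: "'e \<Rightarrow> 'f"
  assumes "F_norm normE"
    and "F_norm normF"
    and "\<exists>r>0. doubling_inf normF r > 1"
    and "V 0 = 0"
    and "\<And>x y. normF (V x - V y) = normE (x - y)"
    and "\<And>x y. 2 *\<^sub>R V x - V y \<in> range V"
  shows "linear V"
proof -
  obtain r where "0 < r" "1 < doubling_inf normF r"
    using assms(3) by blast
  moreover from this obtain \<alpha> where
    "1 < \<alpha>" "\<And>y. normF (2 *\<^sub>R y) \<le> r \<Longrightarrow> \<alpha> * normF y \<le> normF (2 *\<^sub>R y)"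
    using F_norm.doubling_inf_gt_1D[OF assms(2)] by blast
  ultimately have "V (m + h) + V (m - h) = 2 *\<^sub>R V m" if "normE h \<le> r / 4" for m h
    using that assms(1,2,5,6)
    by (intro isometry_preserves_short_midpoint[where N = normE and M = normF and r = r]) auto
  then have mid: "V (m + h) + V (m - h) = 2 *\<^sub>R V m" for m h
    using short_midpoints_imp_midpoints[OF assms(1), of "r / 4" V] \<open>0 < r\<close> by simp
  have add: "V (x + y) = V x + V y" for x y
  proof -
    \<comment> \<open>The segments from \<open>x\<close> to \<open>y\<close> and from
      \<open>x + y\<close> to 0 share their midpoint; \<open>V 0 = 0\<close> removes the fourth
      endpoint.\<close>
    have half: "(1/2) *\<^sub>R (x + y) + (1/2) *\<^sub>R (x - y) = x" "(1/2) *\<^sub>R (x + y) - (1/2) *\<^sub>R (x - y) = y"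
      by (simp_all add: algebra_simps flip: scaleR_add_left)
    have "V (x + y) = 2 *\<^sub>R V ((1/2) *\<^sub>R (x + y))"
      using mid[of "(1/2) *\<^sub>R (x + y)" "(1/2) *\<^sub>R (x + y)"] \<open>V 0 = 0\<close>
      by (simp flip: scaleR_add_left)
    also have "\<dots> = V x + V y"
      using mid[of "(1/2) *\<^sub>R (x + y)" "(1/2) *\<^sub>R (x - y)"] by (simp only: half)
    finally show ?thesis .
  qed
  show ?thesis
    using add additive_isometry_scaleR[OF assms(1,2,5) add] by (rule linearI)
qed

end
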